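(* Let $\boldsymbol n_B\in\mathbb R^3$ be a unit vector and let $\rho(\boldsymbol r)=\tfrac12(\mathbb I+\boldsymbol r\cdot\boldsymbol\sigma)$ be a qubit state whose Bloch vector $\boldsymbol r\in\mathbb R^3$ has components $r_\parallel=\boldsymbol r\cdot\boldsymbol n_B$ and $r_\perp=|\boldsymbol r\times\boldsymbol n_B|$, with $r_\parallel^2+r_\perp^2\le 1$. For every choice of the second measurement basis, parametrized by $(\theta,\psi)\in[0,\pi]\times[0,2\pi)$, $$\mathcal N_{KD}\big(\rho(\boldsymbol r);\theta,\psi\big)\;\le\;\frac14\Big[\sqrt{(1+r_\parallel)^2+r_\perp^2}+\sqrt{(1-r_\parallel)^2+r_\perp^2}\Big]-\frac12 .$$ Equality is attained at $\theta=\pi/2$ and $\psi\in\{\pi/2,3\pi/2\}$. If $r_\perp>0$, this is the only maximizer of $(\theta,\psi)\mapsto \mathcal N_{KD}(\rho(\boldsymbol r);\theta,\psi)$ over $[0,\pi]\times[0,2\pi)$, up to the reflection $\psi\mapsto\psi+\pi$.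
   Context: $\boldsymbol\sigma=(\sigma_x,\sigma_y,\sigma_z)$ are the Pauli matrices. The reference (first) basis is the eigenbasis of $\boldsymbol n_B\cdot\boldsymbol\sigma$, with projectors $\Pi_i^{n_B}=\tfrac12(\mathbb I+(-1)^i\boldsymbol n_B\cdot\boldsymbol\sigma)$, $i\in\{0,1\}$. Choose Cartesian axes with $\hat z=\boldsymbol n_B$ and with the component of $\boldsymbol r$ orthogonal to $\boldsymbol n_B$ equal to $r_\perp\hat x$. The second basis with parameters $(\theta,\psi)$ is the eigenbasis of $\hat u\cdot\boldsymbol\sigma$, $\hat u=(\sin\theta\cos\psi,\sin\theta\sin\psi,\cos\theta)$, with projectors $\Pi_k^{\hat u}=\tfrac12(\mathbb I+(-1)^k\hat u\cdot\boldsymbol\sigma)$, $k\in\{0,1\}$. The Kirkwood-Dirac (KD) quasiprobabilities of $\rho$ are $Q_{ik}=\mathrm{Tr}[\Pi_k^{\hat u}\Pi_i^{n_B}\rho]$, and the KD sum-negativity for this pair of bases is $\mathcal N_{KD}(\rho;\theta,\psi)=\tfrac12\big(\sum_{i,k\in\{0,1\}}|Q_{ik}|-1\big)$. *)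

theory Defs
  imports "HOL-Analysis.Analysis"
begin

definition sigma_x :: "complex^2^2" where
  "sigma_x = vector [vector [0, 1], vector [1, 0]]"

definition sigma_y :: "complex^2^2" where
  "sigma_y = vector [vector [0, -\<i>], vector [\<i>, 0]]"

definition sigma_z :: "complex^2^2" where
  "sigma_z = vector [vector [1, 0], vector [0, -1]]"

definition pauli_dot :: "real^3 \<Rightarrow> complex^2^2" where
  "pauli_dot v = (v $ 1) *\<^sub>R sigma_x + (v $ 2) *\<^sub>R sigma_y + (v $ 3) *\<^sub>R sigma_z"

definition bloch_state :: "real^3 \<Rightarrow> complex^2^2" where
  "bloch_state r = (1/2) *\<^sub>R (mat 1 + pauli_dot r)"

definition basis_projector :: "real^3 \<Rightarrow> nat \<Rightarrow> complex^2^2" where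
  "basis_projector v i = (1/2) *\<^sub>R (mat 1 + (-1)^i *\<^sub>R pauli_dot v)"

definition KD :: "real^3 \<Rightarrow> real^3 \<Rightarrow> complex^2^2 \<Rightarrow> nat \<Rightarrow> nat \<Rightarrow> complex" where
  "KD n u \<rho> i k = trace (basis_projector u k ** basis_projector n i ** \<rho>)"

definition KD_sum_negativity :: "real^3 \<Rightarrow> real^3 \<Rightarrow> complex^2^2 \<Rightarrow> real" where
  "KD_sum_negativity n u \<rho> =
     1/2 * ((\<Sum>i\<in>{0,1}. \<Sum>k\<in>{0,1}. cmod (KD n u \<rho> i k)) - 1)"

text \<open>
  Right-handed Cartesian axes \<open>ex\<close>, \<open>ey\<close>, \<open>ez\<close> with \<open>ez = n\<close> and with the component of \<open>r\<close>
  orthogonal to \<open>n\<close> pointing along \<open>ex\<close>.  If \<open>r\<close> is parallel to \<open>n\<close>, the last condition holds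
  for every \<open>ex\<close>, so that \<open>ex\<close> may be any unit vector orthogonal to \<open>n\<close>.
\<close>
definition adapted_axes :: "real^3 \<Rightarrow> real^3 \<Rightarrow> real^3 \<Rightarrow> real^3 \<Rightarrow> real^3 \<Rightarrow> bool" where
  "adapted_axes n r ex ey ez \<longleftrightarrow>
     ez = n \<and> norm ex = 1 \<and> ex \<bullet> ez = 0 \<and> ey = cross3 ez ex \<and>
     r - (r \<bullet> n) *\<^sub>R n = norm (cross3 r n) *\<^sub>R ex"

definition spherical_direction :: "real^3 \<Rightarrow> real^3 \<Rightarrow> real^3 \<Rightarrow> real \<Rightarrow> real \<Rightarrow> real^3" where
  "spherical_direction ex ey ez \<theta> \<psi> =
     (sin \<theta> * cos \<psi>) *\<^sub>R ex + (sin \<theta> * sin \<psi>) *\<^sub>R ey + cos \<theta> *\<^sub>R ez"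

lemma adapted_axes_exist:
  assumes n: "norm n = 1"
  shows "\<exists>ex ey ez. adapted_axes n r ex ey ez"
proof -
  define w where "w = r - (r \<bullet> n) *\<^sub>R n"
  have nn: "n \<bullet> n = 1" using n by (simp add: dot_square_norm)
  have orth: "w \<bullet> n = 0" by (simp add: w_def inner_diff_left nn)
  have "(norm w)\<^sup>2 = r \<bullet> r - (r \<bullet> n)\<^sup>2"
    unfolding w_def power2_norm_eq_inner
    by (simp add: inner_diff_left inner_diff_right nn inner_commute power2_eq_square)
  hence "(norm (cross3 r n))\<^sup>2 = (norm w)\<^sup>2"
    using norm_cross[of r n] n by (simp add: power2_norm_eq_inner)
  hence nw: "norm (cross3 r n) = norm w" by simp
  have "\<exists>e. norm e = 1 \<and> e \<bullet> n = 0 \<and> w = norm w *\<^sub>R e"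
  proof (cases "w = 0")
    case True
    obtain y where "y \<noteq> 0" "orthogonal n y"
      using orthogonal_to_vector_exists[of n] by auto
    then show ?thesis
      using True by (intro exI[of _ "y /\<^sub>R norm y"]) (auto simp: orthogonal_def inner_commute)
  next
    case False
    then show ?thesis
      using orth by (intro exI[of _ "w /\<^sub>R norm w"]) simp
  qed
  then show ?thesis
    using nw by (auto simp: adapted_axes_def w_def)
qed

end

theory Submission
  imports Defs
begin

text \<open>
  For a fixed outcome \<open>t = \<plusminus>1\<close> of the reference basis, put \<open>a = 1 + t r\<^sub>\<parallel>\<close>, \<open>p = r\<^sub>\<bottom>\<close> and let
  \<open>(X, Y, c)\<close> be the adapted coordinates of \<open>u\<close>.  The two quasiprobabilities have moduli equal to
  a quarter of the distances from the point \<open>(a t c + p X, p Y)\<close> to \<open>(\<plusminus>a, 0)\<close>.  By Cauchy-Schwarz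
  this point lies in the ellipse with these foci and semi-axes \<open>sqrt (a\<^sup>2 + p\<^sup>2)\<close> and \<open>p\<close>, so the
  distances add up to at most \<open>2 sqrt (a\<^sup>2 + p\<^sup>2)\<close>.  If \<open>p > 0\<close>, equality for both values of \<open>t\<close>
  forces \<open>p c = (1 + r\<^sub>\<parallel>) X\<close> and \<open>- p c = (1 - r\<^sub>\<parallel>) X\<close>, hence \<open>X = c = 0\<close>.
\<close>

text \<open>Expand the product: the single \<open>pauli_dot\<close> factors are traceless, two of
  them have trace twice their inner product, and all three together have trace
  \<open>2 * \<i>\<close> times the triple product. Hence the imaginary part is the triple product
  alone. The identity is checked entrywise.\<close>

lemma trace_pauli_product:
  fixes s t :: real and u n r :: "real^3"
  shows "trace (((1/2) *\<^sub>R (mat 1 + s *\<^sub>R pauli_dot u)) ** ((1/2) *\<^sub>R (mat 1 + t *\<^sub>R pauli_dot n))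
      ** ((1/2) *\<^sub>R (mat 1 + pauli_dot r)))
    = Complex ((1 + s * t * (u \<bullet> n) + s * (u \<bullet> r) + t * (n \<bullet> r)) / 4)
        (s * t * (u \<bullet> cross3 n r) / 4)"
  by (simp add: trace_def matrix_matrix_mult_def sum_2 sum_3 inner_vec_def cross3_def mat_def
      pauli_dot_def sigma_x_def sigma_y_def sigma_z_def complex_eq_iff)
     (simp add: field_simps)

text \<open>The outcome signs disappear from the squared imaginary part, so all four
  quasiprobabilities share it and differ only in their real parts.\<close>

lemma cmod_KD_bloch_state:
  "cmod (KD n u (bloch_state r) i k) =
    sqrt ((1 + (-1)^k * (-1)^i * (u \<bullet> n) + (-1)^k * (u \<bullet> r) + (-1)^i * (n \<bullet> r))\<^sup>2
      + (u \<bullet> cross3 n r)\<^sup>2) / 4"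
proof -
  have "KD n u (bloch_state r) i k =
      Complex ((1 + (-1)^k * (-1)^i * (u \<bullet> n) + (-1)^k * (u \<bullet> r) + (-1)^i * (n \<bullet> r)) / 4)
        ((-1)^k * (-1)^i * (u \<bullet> cross3 n r) / 4)"
    unfolding KD_def basis_projector_def bloch_state_def by (rule trace_pauli_product)
  moreover have "((-1)^k * (-1)^i * (u \<bullet> cross3 n r))\<^sup>2 = (u \<bullet> cross3 n r)\<^sup>2"
    by (simp add: power_mult_distrib flip: power_mult)
  ultimately show ?thesis
    by (simp add: cmod_def power_divide real_sqrt_divide flip: add_divide_distrib)
qed

lemma ellipse_focal_sum:
  fixes a p w y :: real
  assumes "w\<^sup>2 \<le> (a\<^sup>2 + p\<^sup>2) * (1 - y\<^sup>2)"
  shows "sqrt ((a + w)\<^sup>2 + p\<^sup>2 * y\<^sup>2) + sqrt ((a - w)\<^sup>2 + p\<^sup>2 * y\<^sup>2) \<le> 2 * sqrt (a\<^sup>2 + p\<^sup>2)"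
    and "p \<noteq> 0 \<Longrightarrow> w\<^sup>2 < (a\<^sup>2 + p\<^sup>2) * (1 - y\<^sup>2) \<Longrightarrow>
      sqrt ((a + w)\<^sup>2 + p\<^sup>2 * y\<^sup>2) + sqrt ((a - w)\<^sup>2 + p\<^sup>2 * y\<^sup>2) < 2 * sqrt (a\<^sup>2 + p\<^sup>2)"
proof -
  define R where "R = sqrt (a\<^sup>2 + p\<^sup>2)"
  have R2: "R\<^sup>2 = a\<^sup>2 + p\<^sup>2" and R0: "0 \<le> R" by (simp_all add: R_def)
  have aR: "\<bar>a\<bar> \<le> R" unfolding R_def by (rule real_le_rsqrt) simp
  have wR: "\<bar>w\<bar> \<le> R"
    unfolding R_def
  proof (rule real_le_rsqrt)
    have "(a\<^sup>2 + p\<^sup>2) * (1 - y\<^sup>2) \<le> (a\<^sup>2 + p\<^sup>2) * 1" by (intro mult_left_mono) auto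
    then show "\<bar>w\<bar>\<^sup>2 \<le> a\<^sup>2 + p\<^sup>2" using assms by simp
  qed
  \<comment> \<open>\<open>R + b * w / R\<close> is the focal radius: the distance to the focus
    \<open>(-b, 0)\<close> from the point with abscissa \<open>w\<close> on the ellipse. Inside the
    ellipse the squared distance is smaller by \<open>p\<^sup>2 / R\<^sup>2\<close> times the slack
    in the hypothesis. For \<open>b = a\<close> and \<open>b = -a\<close> the linear terms cancel,
    and the focal radii add up to \<open>2 * R\<close>.\<close>
  have foc: "0 \<le> R + b * w / R"
      "(b + w)\<^sup>2 + p\<^sup>2 * y\<^sup>2 = (R + b * w / R)\<^sup>2 - p\<^sup>2 * ((a\<^sup>2 + p\<^sup>2) * (1 - y\<^sup>2) - w\<^sup>2) / R\<^sup>2"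
    if "R > 0" "b = a \<or> b = -a" for b
  proof -
    have "\<bar>b * w\<bar> \<le> R * R"
      unfolding abs_mult using aR wR that by (intro mult_mono) auto
    then have "- (R * R) \<le> b * w" by linarith
    then show "0 \<le> R + b * w / R" using that(1) by (simp add: field_simps)
    have b: "b\<^sup>2 = a\<^sup>2" using that by auto
    have "(R + b * w / R)\<^sup>2 = R\<^sup>2 + 2 * b * w + a\<^sup>2 * w\<^sup>2 / R\<^sup>2"
      using that(1) by (simp add: power2_sum power_divide power_mult_distrib b)
    moreover have "a\<^sup>2 * w\<^sup>2 / R\<^sup>2 = w\<^sup>2 - p\<^sup>2 * w\<^sup>2 / R\<^sup>2"
    proof -
      have "a\<^sup>2 * w\<^sup>2 = R\<^sup>2 * w\<^sup>2 - p\<^sup>2 * w\<^sup>2" by (simp add: R2 algebra_simps)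
      then show ?thesis using that(1) by (simp add: diff_divide_distrib)
    qed
    moreover have "p\<^sup>2 * ((a\<^sup>2 + p\<^sup>2) * (1 - y\<^sup>2) - w\<^sup>2) / R\<^sup>2 = p\<^sup>2 * (1 - y\<^sup>2) - p\<^sup>2 * w\<^sup>2 / R\<^sup>2"
      unfolding R2[symmetric] using that(1) by (simp add: field_simps)
    moreover have "(b + w)\<^sup>2 = a\<^sup>2 + 2 * b * w + w\<^sup>2" by (simp add: power2_sum b)
    ultimately show "(b + w)\<^sup>2 + p\<^sup>2 * y\<^sup>2
        = (R + b * w / R)\<^sup>2 - p\<^sup>2 * ((a\<^sup>2 + p\<^sup>2) * (1 - y\<^sup>2) - w\<^sup>2) / R\<^sup>2"
      by (simp add: R2 algebra_simps)
  qed
  have flip: "(a - w)\<^sup>2 = (- a + w)\<^sup>2" by (simp add: power2_commute)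
  show "sqrt ((a + w)\<^sup>2 + p\<^sup>2 * y\<^sup>2) + sqrt ((a - w)\<^sup>2 + p\<^sup>2 * y\<^sup>2) \<le> 2 * sqrt (a\<^sup>2 + p\<^sup>2)"
  proof (cases "R > 0")
    case True
    have "sqrt ((b + w)\<^sup>2 + p\<^sup>2 * y\<^sup>2) \<le> R + b * w / R" if "b = a \<or> b = -a" for b
    proof (rule real_le_lsqrt)
      have "0 \<le> p\<^sup>2 * ((a\<^sup>2 + p\<^sup>2) * (1 - y\<^sup>2) - w\<^sup>2) / R\<^sup>2" using assms by simp
      then show "(b + w)\<^sup>2 + p\<^sup>2 * y\<^sup>2 \<le> (R + b * w / R)\<^sup>2" using foc(2)[OF True that] by linarith
    qed (use foc(1)[OF True that] in auto)
    from this[of a] this[of "-a"] show ?thesis unfolding flip R_def[symmetric] by simp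
  next
    \<comment> \<open>Degenerate ellipse: \<open>R = 0\<close> forces \<open>a = p = w = 0\<close>,
      and both sides vanish.\<close>
    case False
    then have "R = 0" using R0 by simp
    then show ?thesis using aR wR R2 by simp
  qed
  assume p: "p \<noteq> 0" and strict: "w\<^sup>2 < (a\<^sup>2 + p\<^sup>2) * (1 - y\<^sup>2)"
  have R_pos: "R > 0" unfolding R_def using p by (simp add: add_nonneg_pos)
  have "sqrt ((b + w)\<^sup>2 + p\<^sup>2 * y\<^sup>2) < R + b * w / R" if "b = a \<or> b = -a" for b
  proof -
    have "0 < p\<^sup>2 * ((a\<^sup>2 + p\<^sup>2) * (1 - y\<^sup>2) - w\<^sup>2) / R\<^sup>2" using strict p R_pos by simp
    then have "(b + w)\<^sup>2 + p\<^sup>2 * y\<^sup>2 < (R + b * w / R)\<^sup>2" using foc(2)[OF R_pos that] by linarith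
    then have "sqrt ((b + w)\<^sup>2 + p\<^sup>2 * y\<^sup>2) < sqrt ((R + b * w / R)\<^sup>2)"
      by (rule real_sqrt_less_mono)
    then show ?thesis using foc(1)[OF R_pos that] by simp
  qed
  from this[of a] this[of "-a"]
  show "sqrt ((a + w)\<^sup>2 + p\<^sup>2 * y\<^sup>2) + sqrt ((a - w)\<^sup>2 + p\<^sup>2 * y\<^sup>2) < 2 * sqrt (a\<^sup>2 + p\<^sup>2)"
    unfolding flip R_def[symmetric] by simp
qed

text \<open>Lagrange's identity for the vectors \<open>(a, p)\<close> and \<open>(c, X)\<close>
  gives the slack in the ellipse condition exactly, as \<open>(p * c - a * X)\<^sup>2\<close>.
  Strictness therefore means that these vectors are not parallel.\<close>

lemma focal_sum_unit_vector:
  fixes a p X Y c :: real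
  assumes "X\<^sup>2 + Y\<^sup>2 + c\<^sup>2 = 1"
  defines "S \<equiv> sqrt ((a + (a * c + p * X))\<^sup>2 + p\<^sup>2 * Y\<^sup>2) + sqrt ((a - (a * c + p * X))\<^sup>2 + p\<^sup>2 * Y\<^sup>2)"
  shows "S \<le> 2 * sqrt (a\<^sup>2 + p\<^sup>2)"
    and "p \<noteq> 0 \<Longrightarrow> p * c \<noteq> a * X \<Longrightarrow> S < 2 * sqrt (a\<^sup>2 + p\<^sup>2)"
proof -
  have Y: "1 - Y\<^sup>2 = c\<^sup>2 + X\<^sup>2" using assms(1) by simp
  have eq: "(a\<^sup>2 + p\<^sup>2) * (1 - Y\<^sup>2) = (a * c + p * X)\<^sup>2 + (p * c - a * X)\<^sup>2"
    unfolding Y by (simp add: power2_eq_square algebra_simps)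
  have le: "(a * c + p * X)\<^sup>2 \<le> (a\<^sup>2 + p\<^sup>2) * (1 - Y\<^sup>2)" unfolding eq by simp
  show "S \<le> 2 * sqrt (a\<^sup>2 + p\<^sup>2)" unfolding S_def by (rule ellipse_focal_sum(1)[OF le])
  assume "p \<noteq> 0" "p * c \<noteq> a * X"
  then have "(a * c + p * X)\<^sup>2 < (a\<^sup>2 + p\<^sup>2) * (1 - Y\<^sup>2)" unfolding eq by simp
  with \<open>p \<noteq> 0\<close> show "S < 2 * sqrt (a\<^sup>2 + p\<^sup>2)"
    unfolding S_def by (intro ellipse_focal_sum(2)[OF le])
qed

text \<open>The moduli are grouped by the reference outcome \<open>i\<close>; within a group,
  \<open>k\<close> selects the focus. For \<open>i = 1\<close> the sign is moved onto
  \<open>c\<close>, so that both groups have the shape of \<open>focal_sum_unit_vector\<close>, with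
  \<open>a = 1 + q\<close> and \<open>a = 1 - q\<close>.\<close>

lemma KD_sum_negativity_adapted:
  fixes n r ex ey ez :: "real^3" and \<theta> \<psi> :: real
  assumes n: "norm n = 1" and ax: "adapted_axes n r ex ey ez"
  defines "q \<equiv> r \<bullet> n" and "p \<equiv> norm (cross3 r n)"
    and "X \<equiv> sin \<theta> * cos \<psi>" and "Y \<equiv> sin \<theta> * sin \<psi>" and "c \<equiv> cos \<theta>"
  shows "KD_sum_negativity n (spherical_direction ex ey ez \<theta> \<psi>) (bloch_state r) =
    ((sqrt (((1 + q) + ((1 + q) * c + p * X))\<^sup>2 + p\<^sup>2 * Y\<^sup>2)
        + sqrt (((1 + q) - ((1 + q) * c + p * X))\<^sup>2 + p\<^sup>2 * Y\<^sup>2))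
      + (sqrt (((1 - q) + ((1 - q) * (- c) + p * X))\<^sup>2 + p\<^sup>2 * Y\<^sup>2)
        + sqrt (((1 - q) - ((1 - q) * (- c) + p * X))\<^sup>2 + p\<^sup>2 * Y\<^sup>2))) / 8 - 1 / 2"
proof -
  define u where "u = spherical_direction ex ey ez \<theta> \<psi>"
  have ez: "ez = n" and ex: "norm ex = 1" and exn: "ex \<bullet> n = 0" and ey: "ey = cross3 n ex"
    and rx: "r - q *\<^sub>R n = p *\<^sub>R ex"
    using ax by (auto simp: adapted_axes_def q_def p_def)
  have r: "r = q *\<^sub>R n + p *\<^sub>R ex" using rx by (simp add: algebra_simps)
  have nn: "n \<bullet> n = 1" and xx: "ex \<bullet> ex = 1" using n ex by (simp_all add: dot_square_norm)
  have yx: "ey \<bullet> ex = 0" and yn: "ey \<bullet> n = 0" by (simp_all add: ey dot_cross_self)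
  have yy: "ey \<bullet> ey = 1"
    using norm_cross[of n ex] n ex exn unfolding ey by (simp add: power2_norm_eq_inner inner_commute)
  have u: "u = X *\<^sub>R ex + Y *\<^sub>R ey + c *\<^sub>R n"
    by (simp add: u_def spherical_direction_def X_def Y_def c_def ez)
  have un: "u \<bullet> n = c" by (simp add: u inner_add_left exn yn nn)
  have ux: "u \<bullet> ex = X"
    by (simp add: u inner_add_left xx yx inner_commute[of n ex] exn)
  have uy: "u \<bullet> ey = Y"
    by (simp add: u inner_add_left yy inner_commute[of ex ey] inner_commute[of n ey] yx yn)
  have ur: "u \<bullet> r = q * c + p * X" by (simp add: r inner_add_right un ux)
  \<comment> \<open>The part of \<open>r\<close> along \<open>n\<close> drops out, so the triple
    product reads off the \<open>ey\<close> coordinate of \<open>u\<close>.\<close>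
  have "cross3 n r = p *\<^sub>R ey" by (simp add: r ey cross_add_right cross_mult_right)
  then have uc: "(u \<bullet> cross3 n r)\<^sup>2 = p\<^sup>2 * Y\<^sup>2" by (simp add: uy power_mult_distrib)
  have nr: "n \<bullet> r = q" by (simp add: q_def inner_commute)
  show ?thesis
    unfolding u_def[symmetric] KD_sum_negativity_def cmod_KD_bloch_state
    by (simp add: un ur uc nr algebra_simps)
qed

theorem theorem4:
  fixes n r ex ey ez :: "real^3" and r_par r_perp :: real
    and N :: "real \<Rightarrow> real \<Rightarrow> real" and B :: real
  assumes "norm n = 1"
    and "r_par = r \<bullet> n"
    and "r_perp = norm (cross3 r n)"
    and "r_par\<^sup>2 + r_perp\<^sup>2 \<le> 1"
    and "adapted_axes n r ex ey ez"
    and "N = (\<lambda>\<theta> \<psi>. KD_sum_negativity n (spherical_direction ex ey ez \<theta> \<psi>) (bloch_state r))"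
    and "B = 1/4 * (sqrt ((1 + r_par)\<^sup>2 + r_perp\<^sup>2) + sqrt ((1 - r_par)\<^sup>2 + r_perp\<^sup>2)) - 1/2"
  shows "(\<forall>\<theta>\<in>{0..pi}. \<forall>\<psi>\<in>{0..<2*pi}. N \<theta> \<psi> \<le> B)
    \<and> (\<forall>\<psi>\<in>{pi/2, 3*pi/2}. N (pi/2) \<psi> = B)
    \<and> (r_perp > 0 \<longrightarrow>
         {p. is_arg_max (\<lambda>(\<theta>, \<psi>). N \<theta> \<psi>) (\<lambda>p. p \<in> {0..pi} \<times> {0..<2*pi}) p}
           = {(pi/2, pi/2), (pi/2, 3*pi/2)})"
proof -
  \<comment> \<open>\<open>t\<close> stands for the sign \<open>(-1)^i\<close>. Attaching it to
    \<open>cos \<theta>\<close> keeps the coordinate triple on the unit sphere, so one estimate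
    serves both outcomes.\<close>
  define S where "S t \<theta> \<psi> =
      (let a = 1 + t * r_par; w = a * (t * cos \<theta>) + r_perp * (sin \<theta> * cos \<psi>);
           h = r_perp\<^sup>2 * (sin \<theta> * sin \<psi>)\<^sup>2
       in sqrt ((a + w)\<^sup>2 + h) + sqrt ((a - w)\<^sup>2 + h))" for t \<theta> \<psi> :: real
  define R where "R t = sqrt ((1 + t * r_par)\<^sup>2 + r_perp\<^sup>2)" for t
  have N: "N \<theta> \<psi> = (S 1 \<theta> \<psi> + S (-1) \<theta> \<psi>) / 8 - 1/2" for \<theta> \<psi>
    unfolding assms(6) KD_sum_negativity_adapted[OF assms(1,5)] assms(2)[symmetric]
      assms(3)[symmetric] S_def Let_def by simp
  have B: "B = (2 * R 1 + 2 * R (-1)) / 8 - 1/2"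
    unfolding assms(7) R_def by simp
  have unit: "(sin \<theta> * cos \<psi>)\<^sup>2 + (sin \<theta> * sin \<psi>)\<^sup>2 + (t * cos \<theta>)\<^sup>2 = 1"
    if "t\<^sup>2 = 1" for t \<theta> \<psi> :: real
  proof -
    have "(sin \<theta> * cos \<psi>)\<^sup>2 + (sin \<theta> * sin \<psi>)\<^sup>2 = (sin \<theta>)\<^sup>2 * ((cos \<psi>)\<^sup>2 + (sin \<psi>)\<^sup>2)"
      by (simp only: power_mult_distrib distrib_left)
    then show ?thesis using that by (simp add: power_mult_distrib)
  qed
  have S_le: "S t \<theta> \<psi> \<le> 2 * R t" if "t\<^sup>2 = 1" for t \<theta> \<psi>
    unfolding S_def R_def Let_def by (rule focal_sum_unit_vector(1)[OF unit[OF that]])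
  have S_less: "S t \<theta> \<psi> < 2 * R t"
    if "t\<^sup>2 = 1" "r_perp > 0" "r_perp * (t * cos \<theta>) \<noteq> (1 + t * r_par) * (sin \<theta> * cos \<psi>)" for t \<theta> \<psi>
    unfolding S_def R_def Let_def
    by (rule focal_sum_unit_vector(2)[OF unit[OF that(1)]]) (use that in auto)
  have le: "N \<theta> \<psi> \<le> B" for \<theta> \<psi>
    using S_le[of 1 \<theta> \<psi>] S_le[of "-1" \<theta> \<psi>] unfolding N B by simp
  \<comment> \<open>Here \<open>w = 0\<close> and \<open>h = r_perp\<^sup>2\<close> for both signs:
    the point is an end of the minor axis, at distance \<open>R t\<close> from each focus.\<close>
  have eq: "N (pi/2) \<psi> = B" if "\<psi> \<in> {pi/2, 3*pi/2}" for \<psi>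
  proof -
    have "\<psi> = pi/2 \<or> \<psi> = 3/2 * pi" using that by simp
    then have "cos \<psi> = 0" by (elim disjE) (simp_all only: cos_pi_half cos_3over2_pi)
    then have "(sin \<psi>)\<^sup>2 = 1" by (simp add: sin_squared_eq)
    with \<open>cos \<psi> = 0\<close> show ?thesis unfolding N B S_def R_def Let_def by simp
  qed
  have unique: "\<theta> = pi/2 \<and> \<psi> \<in> {pi/2, 3*pi/2}"
    if pos: "r_perp > 0" and dom: "\<theta> \<in> {0..pi}" "\<psi> \<in> {0..<2*pi}" and max: "B \<le> N \<theta> \<psi>" for \<theta> \<psi>
  proof -
    \<comment> \<open>If the sum reaches the sum of the two bounds, each summand reaches its own;
      the contrapositive of \<open>S_less\<close> then yields both parallelism equations.\<close>
    have "2 * R 1 \<le> S 1 \<theta> \<psi>" "2 * R (-1) \<le> S (-1) \<theta> \<psi>"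
      using max S_le[of 1 \<theta> \<psi>] S_le[of "-1" \<theta> \<psi>] unfolding N B by simp_all
    then have 1: "r_perp * cos \<theta> = (1 + r_par) * (sin \<theta> * cos \<psi>)"
      and 2: "- (r_perp * cos \<theta>) = (1 - r_par) * (sin \<theta> * cos \<psi>)"
      using S_less[of 1 \<theta> \<psi>] S_less[of "-1" \<theta> \<psi>] pos by force+
    \<comment> \<open>Adding the two equations cancels \<open>r_par\<close> and leaves
      \<open>0 = 2 * (sin \<theta> * cos \<psi>)\<close>.\<close>
    have X: "sin \<theta> * cos \<psi> = 0" using 1 2 by (simp add: algebra_simps)
    then have c: "cos \<theta> = 0" using 1 pos unfolding X by simp
    then have \<theta>: "\<theta> = pi/2"
      using dom(1) cos_inj_pi[of \<theta> "pi/2"] by simp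
    have "cos \<psi> = 0" using X unfolding \<theta> by simp
    then have "\<psi> = pi/2 \<or> \<psi> = 3*pi/2"
    \<comment> \<open>Cosine is injective only on \<open>{0..pi}\<close>, so larger angles are first
      shifted down by \<open>pi\<close>.\<close>
    proof (cases "\<psi> \<le> pi")
      case True
      then show ?thesis using \<open>cos \<psi> = 0\<close> dom(2) cos_inj_pi[of \<psi> "pi/2"] by simp
    next
      case False
      have "cos (\<psi> - pi) = 0" using \<open>cos \<psi> = 0\<close> by (simp add: cos_diff)
      then have "\<psi> - pi = pi/2" using False dom(2) cos_inj_pi[of "\<psi> - pi" "pi/2"] by simp
      then show ?thesis by simp
    qed
    with \<theta> show ?thesis by simp
  qed
  have dom: "(pi/2, \<psi>) \<in> {0..pi} \<times> {0..<2*pi}" if \<psi>: "\<psi> \<in> {pi/2, 3*pi/2}" for \<psi>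
  proof -
    have "(pi/2, pi/2) \<in> {0..pi} \<times> {0..<2*pi}" "(pi/2, 3*pi/2) \<in> {0..pi} \<times> {0..<2*pi}"
      by simp_all
    then show ?thesis using \<psi> by blast
  qed
  have arg_max: "{p. is_arg_max (\<lambda>(\<theta>, \<psi>). N \<theta> \<psi>) (\<lambda>p. p \<in> {0..pi} \<times> {0..<2*pi}) p}
      = {(pi/2, pi/2), (pi/2, 3*pi/2)}" (is "?M = ?E") if pos: "r_perp > 0"
  proof (intro equalityI subsetI)
    fix x assume M: "x \<in> ?M"
    obtain \<theta> \<psi> where x: "x = (\<theta>, \<psi>)" by (cases x)
    have d: "\<theta> \<in> {0..pi}" "\<psi> \<in> {0..<2*pi}" using M by (simp_all add: is_arg_max_def x)
    have "\<forall>y. y \<in> {0..pi} \<times> {0..<2*pi} \<longrightarrow> \<not> N \<theta> \<psi> < (case y of (\<theta>, \<psi>) \<Rightarrow> N \<theta> \<psi>)"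
      using M by (simp only: mem_Collect_eq is_arg_max_def x split_conv) blast
    \<comment> \<open>Comparing with the competitor \<open>(pi/2, pi/2)\<close>, where
      \<open>B\<close> is attained, turns maximality into the hypothesis of
      \<open>unique\<close>.\<close>
    from this[rule_format, OF dom[of "pi/2"]] have "B \<le> N \<theta> \<psi>" using eq[of "pi/2"] by simp
    from unique[OF pos d this] show "x \<in> ?E" unfolding x by blast
  next
    fix x assume "x \<in> ?E"
    then obtain \<psi> where x: "x = (pi/2, \<psi>)" and \<psi>: "\<psi> \<in> {pi/2, 3*pi/2}" by blast
    have "\<not> N (pi/2) \<psi> < (case y of (\<theta>, \<psi>) \<Rightarrow> N \<theta> \<psi>)" for y
      using le eq[OF \<psi>] by (cases y) (simp add: not_less)
    then show "x \<in> ?M"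
      using dom[OF \<psi>] by (simp only: mem_Collect_eq is_arg_max_def x split_conv) blast
  qed
  show ?thesis by (intro conjI ballI impI le eq arg_max)
qed

end
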